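(* Let $\sigma_0,Q_0\in\mathbb{R}$ satisfy $$0<|\sigma_0|<\frac{\pi}{2},\qquad Q_0\le-\frac{w^6(w^2+2)}{(1-w^2)(w^2+1)^3},\qquad w=\sqrt[3]{\tan\frac{\sigma_0}{2}}$$ (real cube root). Put $$f_2(\sigma)=\cos^3\sigma-\frac32\cos\sigma+\frac12,\quad Q_1=\frac{Q_0-f_2(\sigma_0)}{\sin^3\sigma_0},\quad m=\sqrt[3]{1+Q_1^2},\quad n=\sqrt{m^2+m+1},$$ $$r_1=\sqrt{m-1},\qquad r_2=\sqrt{2n-(m+2)},\qquad r_{12}=r_2^2-r_1^2=2n-(2m+1).$$ Then the solutions $\xi_0,\bar\xi_0$ of the equation $Q(\xi;\sigma_0)=Q_0$ (for polar angles $\xi$, taken modulo $2\pi$, in the admissible intervals given in the context), and the corresponding control points $(p_1,q_1)$, $(p_2,q_2)$ of the parabolic arcs with $\sigma(p,q)=\sigma_0$, $Q(p,q)=Q_0$, are given by $$\theta_0=-r_1\operatorname{sign}Q_1-r_2\operatorname{sign}\sigma_0=\begin{cases}-\dfrac{r_{12}}{r_1+r_2}\operatorname{sign}\sigma_0,&\text{if }\sigma_0Q_1<0,\\[6pt]-(r_1+r_2)\operatorname{sign}\sigma_0,&\text{if }\sigma_0Q_1\ge0,\end{cases}$$ $$\xi_0=\arctan\theta_0,\qquad (p_1,q_1)=\bigl(\rho(\xi_0)\cos\xi_0,\ \rho(\xi_0)\sin\xi_0\bigr),$$ $$\bar\xi_0=\xi_0+\pi,\qquad (p_2,q_2)=(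-p_1,-q_1).$$
   Context: For a control point $(p,q)$, $q\ne0$, consider the parabolic arc $x(t)=-(1-t)^2+2p(1-t)t+t^2$, $y(t)=2qt(1-t)$, $0\le t\le1$. Put $h_1=\sqrt{(1+p)^2+q^2}$, $h_2=\sqrt{(1-p)^2+q^2}$. Let $\alpha,\beta\in(-\pi,\pi)$ be its tangent angles at $t=0,1$: $\cos\alpha=\frac{1+p}{h_1}$, $\sin\alpha=\frac{q}{h_1}$, $\cos\beta=\frac{1-p}{h_2}$, $\sin\beta=\frac{-q}{h_2}$. Its signed curvatures at $t=0,1$ are $a=-q/h_1^3$, $b=-q/h_2^3$. Define $$\sigma(p,q)=\alpha+\beta,\qquad Q(p,q)=(a+\sin\alpha)(b-\sin\beta)+\sin^2\frac{\alpha+\beta}{2}.$$ The control points with $\sigma(p,q)=\sigma_0$ are described in polar coordinates $(\rho,\xi)$, i.e. $p=\rho\cos\xi$, $q=\rho\sin\xi$, by $$\rho(\xi)=\sqrt{\frac{\sin\sigma_0}{\sin(\sigma_0-2\xi)}},$$ where the admissible intervals for $\xi$ (modulo $2\pi$) are: if $\sigma_0>0$, $\ \frac{\sigma_0}{2}-\frac{\pi}{2}<\xi<0$ or $\frac{\pi}{2}+\frac{\sigma_0}{2}<\xi<\pi$; if $\sigma_0<0$, $\ 0<\xi<\frac{\pi}{2}+\frac{\sigma_0}{2}$ or $-\pi<\xi<\frac{\sigma_0}{2}-\frac{\pi}{2}$. $Q(\xi;\sigma_0)$ denotes the value of $Q(p,q)$ at the point $(p,q)=(\rho(\xi)\cos\xi,\rho(\xi)\sin\xi)$;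 explicitly $$Q(\xi;\sigma_0)=f_2(\sigma_0)-\sin^3\sigma_0\,f_1(\xi),\qquad f_1(\xi)=\frac{\tan^4\xi+6\tan^2\xi-3}{8\tan\xi}.$$ The convention $\operatorname{sign}0=0$ is used. *)

theory Defs
  imports "HOL-Analysis.Analysis"
begin

definition parabolic_arc :: "real \<Rightarrow> real \<Rightarrow> real \<Rightarrow> complex" where
  "parabolic_arc p q t =
     Complex (- ((1 - t)^2) + 2 * p * (1 - t) * t + t^2) (2 * q * t * (1 - t))"

definition h1 :: "real \<Rightarrow> real \<Rightarrow> real" where
  "h1 p q = sqrt ((1 + p)^2 + q^2)"

definition h2 :: "real \<Rightarrow> real \<Rightarrow> real" where
  "h2 p q = sqrt ((1 - p)^2 + q^2)"

(* Tangent angles and signed curvatures of the arc at t = 0 and t = 1.  The tangent vectors there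
   are 2 (1 + p, q) and 2 (1 - p, -q).  For q \<noteq> 0 neither lies on the real axis, so Arg
   takes its value in the open interval from -pi to pi; see tangent_angle0_iff and
   tangent_angle1_iff, and parabolic_arc_tangent0 to parabolic_arc_curvature1 below. *)

definition tangent_angle0 :: "real \<Rightarrow> real \<Rightarrow> real" where
  "tangent_angle0 p q = Arg (Complex (1 + p) q)"

definition tangent_angle1 :: "real \<Rightarrow> real \<Rightarrow> real" where
  "tangent_angle1 p q = Arg (Complex (1 - p) (- q))"

definition curvature0 :: "real \<Rightarrow> real \<Rightarrow> real" where
  "curvature0 p q = - q / (h1 p q)^3"

definition curvature1 :: "real \<Rightarrow> real \<Rightarrow> real" where
  "curvature1 p q = - q / (h2 p q)^3"

definition arc_sigma :: "real \<Rightarrow> real \<Rightarrow> real" where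
  "arc_sigma p q = tangent_angle0 p q + tangent_angle1 p q"

definition arc_Q :: "real \<Rightarrow> real \<Rightarrow> real" where
  "arc_Q p q = (curvature0 p q + sin (tangent_angle0 p q)) * (curvature1 p q - sin (tangent_angle1 p q))
           + (sin ((tangent_angle0 p q + tangent_angle1 p q) / 2))^2"

definition rho :: "real \<Rightarrow> real \<Rightarrow> real" where
  "rho \<sigma>\<^sub>0 \<xi> = sqrt (sin \<sigma>\<^sub>0 / sin (\<sigma>\<^sub>0 - 2 * \<xi>))"

definition polar_point :: "real \<Rightarrow> real \<Rightarrow> real \<times> real" where
  "polar_point \<sigma>\<^sub>0 \<xi> = (rho \<sigma>\<^sub>0 \<xi> * cos \<xi>, rho \<sigma>\<^sub>0 \<xi> * sin \<xi>)"

definition Q_polar :: "real \<Rightarrow> real \<Rightarrow> real" where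
  "Q_polar \<sigma>\<^sub>0 \<xi> = arc_Q (fst (polar_point \<sigma>\<^sub>0 \<xi>)) (snd (polar_point \<sigma>\<^sub>0 \<xi>))"

definition base_angles :: "real \<Rightarrow> real set" where
  "base_angles \<sigma>\<^sub>0 =
     (if \<sigma>\<^sub>0 > 0 then {\<sigma>\<^sub>0 / 2 - pi / 2 <..< 0} \<union> {pi / 2 + \<sigma>\<^sub>0 / 2 <..< pi}
      else if \<sigma>\<^sub>0 < 0 then {0 <..< pi / 2 + \<sigma>\<^sub>0 / 2} \<union> {- pi <..< \<sigma>\<^sub>0 / 2 - pi / 2}
      else {})"

definition admissible :: "real \<Rightarrow> real \<Rightarrow> bool" where
  "admissible \<sigma>\<^sub>0 \<xi> \<longleftrightarrow> (\<exists>k::int. \<xi> + 2 * pi * of_int k \<in> base_angles \<sigma>\<^sub>0)"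

definition f2 :: "real \<Rightarrow> real" where
  "f2 \<sigma> = (cos \<sigma>)^3 - 3 / 2 * cos \<sigma> + 1 / 2"

lemma Arg_iff_cos_sin:
  assumes "y \<noteq> 0"
  shows "a = Arg (Complex x y) \<longleftrightarrow>
           - pi < a \<and> a < pi \<and> cos a = x / sqrt (x^2 + y^2) \<and> sin a = y / sqrt (x^2 + y^2)"
proof -
  let ?r = "sqrt (x^2 + y^2)"
  have r: "?r > 0" using assms by (simp add: sum_power2_gt_zero_iff)
  have nz: "Complex x y \<noteq> 0" using assms by (simp add: complex_eq_iff)
  have key: "Complex x y = complex_of_real ?r * exp (\<i> * complex_of_real b) \<longleftrightarrow>
      cos b = x / ?r \<and> sin b = y / ?r" for b
  proof -
    have "Complex x y = complex_of_real s * exp (\<i> * complex_of_real b) \<longleftrightarrow>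
        cos b = x / s \<and> sin b = y / s" if "s > 0" for s
      using that by (auto simp: complex_eq_iff Re_exp Im_exp field_simps)
    then show ?thesis using r by blast
  qed
  show ?thesis
  proof
    assume a: "a = Arg (Complex x y)"
    have "Complex x y = complex_of_real ?r * exp (\<i> * complex_of_real a)"
      using Arg_eq[OF nz] a by (simp add: cmod_def)
    then have cs: "cos a = x / ?r" "sin a = y / ?r" using key by blast+
    have "a \<noteq> pi" using cs assms r by auto
    moreover have "- pi < a" "a \<le> pi"
      using a mpi_less_Arg Arg_le_pi by auto
    ultimately show "- pi < a \<and> a < pi \<and> cos a = x / ?r \<and> sin a = y / ?r"
      using cs by simp
  next
    assume a: "- pi < a \<and> a < pi \<and> cos a = x / ?r \<and> sin a = y / ?r"
    then have "Complex x y = complex_of_real ?r * exp (\<i> * complex_of_real a)"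
      using key by blast
    from Arg_unique[OF this[symmetric] r] a show "a = Arg (Complex x y)" by simp
  qed
qed

lemma tangent_angle0_iff:
  assumes "q \<noteq> 0"
  shows "\<alpha> = tangent_angle0 p q \<longleftrightarrow>
           - pi < \<alpha> \<and> \<alpha> < pi \<and> cos \<alpha> = (1 + p) / h1 p q \<and> sin \<alpha> = q / h1 p q"
  unfolding tangent_angle0_def h1_def using Arg_iff_cos_sin[OF assms] by simp

lemma tangent_angle1_iff:
  assumes "q \<noteq> 0"
  shows "\<beta> = tangent_angle1 p q \<longleftrightarrow>
           - pi < \<beta> \<and> \<beta> < pi \<and> cos \<beta> = (1 - p) / h2 p q \<and> sin \<beta> = - q / h2 p q"
  unfolding tangent_angle1_def h2_def using Arg_iff_cos_sin[of "- q"] assms by simp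

definition arc_velocity :: "real \<Rightarrow> real \<Rightarrow> real \<Rightarrow> complex" where
  "arc_velocity p q t = vector_derivative (parabolic_arc p q) (at t)"

definition arc_acceleration :: "real \<Rightarrow> real \<Rightarrow> real \<Rightarrow> complex" where
  "arc_acceleration p q t = vector_derivative (arc_velocity p q) (at t)"

lemma arc_velocity_eq:
  "arc_velocity p q t = Complex (2 * (1 - t) + 2 * p * (1 - 2 * t) + 2 * t) (2 * q * (1 - 2 * t))"
proof -
  have "(parabolic_arc p q has_vector_derivative
      Complex (2 * (1 - t) + 2 * p * (1 - 2 * t) + 2 * t) (2 * q * (1 - 2 * t))) (at t)"
    unfolding parabolic_arc_def has_vector_derivative_complex_iff
    by (auto intro!: derivative_eq_intros simp: algebra_simps)
  then show ?thesis unfolding arc_velocity_def by (rule vector_derivative_at)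
qed

lemma arc_acceleration_eq: "arc_acceleration p q t = Complex (- 4 * p) (- 4 * q)"
proof -
  have "(arc_velocity p q has_vector_derivative Complex (- 4 * p) (- 4 * q)) (at t)"
    unfolding arc_velocity_eq[abs_def] has_vector_derivative_complex_iff
    by (auto intro!: derivative_eq_intros simp: algebra_simps)
  then show ?thesis unfolding arc_acceleration_def by (rule vector_derivative_at)
qed

lemma parabolic_arc_tangent0: "tangent_angle0 p q = Arg (arc_velocity p q 0)"
proof -
  have "arc_velocity p q 0 = of_real 2 * Complex (1 + p) q"
    by (simp add: arc_velocity_eq complex_eq_iff)
  then show ?thesis unfolding tangent_angle0_def by (metis Arg_times_of_real2 Arg_times_of_real zero_less_numeral)
qed

lemma parabolic_arc_tangent1: "tangent_angle1 p q = Arg (arc_velocity p q 1)"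
proof -
  have "arc_velocity p q 1 = of_real 2 * Complex (1 - p) (- q)"
    by (simp add: arc_velocity_eq complex_eq_iff)
  then show ?thesis unfolding tangent_angle1_def by (metis Arg_times_of_real2 Arg_times_of_real zero_less_numeral)
qed

(* Im (cnj v * u) is the cross product v_x u_y - v_y u_x. *)

lemma parabolic_arc_curvature0:
  "curvature0 p q =
    Im (cnj (arc_velocity p q 0) * arc_acceleration p q 0) / cmod (arc_velocity p q 0) ^ 3"
proof -
  have "arc_velocity p q 0 = of_real 2 * Complex (1 + p) q"
    by (simp add: arc_velocity_eq complex_eq_iff)
  then have "cmod (arc_velocity p q 0) = 2 * h1 p q"
    by (simp only: norm_mult norm_of_real) (simp add: h1_def cmod_def)
  then show ?thesis
    by (simp add: curvature0_def arc_velocity_eq arc_acceleration_eq power_mult_distrib algebra_simps)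
qed

lemma parabolic_arc_curvature1:
  "curvature1 p q =
    Im (cnj (arc_velocity p q 1) * arc_acceleration p q 1) / cmod (arc_velocity p q 1) ^ 3"
proof -
  have "arc_velocity p q 1 = of_real 2 * Complex (1 - p) (- q)"
    by (simp add: arc_velocity_eq complex_eq_iff)
  then have "cmod (arc_velocity p q 1) = 2 * h2 p q"
    by (simp only: norm_mult norm_of_real) (simp add: h2_def cmod_def)
  then show ?thesis
    by (simp add: curvature1_def arc_velocity_eq arc_acceleration_eq power_mult_distrib algebra_simps)
qed

end

theory Submission
  imports Defs
begin

text \<open>
  With \<open>z = p + i q\<close> the tangent angles are the arguments of \<open>1 + z\<close> and \<open>1 - z\<close>. They have
  opposite signs, so \<open>\<sigma>\<close> is the argument of \<open>1 - z\<^sup>2\<close>, and \<open>\<sigma>(p, q) = \<sigma>\<^sub>0\<close> says that \<open>1 - z\<^sup>2\<close> is a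
  positive multiple of \<open>exp (i \<sigma>\<^sub>0)\<close>. In terms of the slope \<open>t = q / p = tan \<xi>\<close> and
  \<open>T = tan (\<sigma>\<^sub>0 / 2)\<close> this becomes
  \[ t T < 0, \qquad p^2 (1 + t T) (1 - t / T) = 1 \]
  (lemma \<open>arc_sigma_eq_iff_slope\<close>). Hence the slopes that occur are those with \<open>- 1 < t T < 0\<close>, which
  are exactly the tangents of the admissible angles, and each slope belongs to one pair of opposite
  points.

  On this curve \<open>Q = f2 \<sigma>\<^sub>0 - sin\<^sup>3 \<sigma>\<^sub>0 f(t)\<close> with \<open>f(t) = (t\<^sup>4 + 6 t\<^sup>2 - 3) / (8 t)\<close> (lemma
  \<open>arc_Q_eq_tan_profile\<close>). Since \<open>f\<close> increases strictly on each half-line, the equation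
  \<open>f(t) = - Q\<^sub>1\<close> has at most one solution whose sign is opposite to that of \<open>\<sigma>\<^sub>0\<close>. The number
  \<open>\<theta>\<^sub>0\<close> is that solution: the quartic \<open>t\<^sup>4 + 6 t\<^sup>2 + 8 Q\<^sub>1 t - 3\<close> splits by Ferrari's method into two
  quadratics, whose real roots are \<open>- r \<plusminus> r\<^sub>2\<close> with \<open>r = r\<^sub>1 sgn Q\<^sub>1\<close>, and \<open>r\<^sub>1 < r\<^sub>2\<close>
  fixes their signs.

  It remains to see that \<open>\<theta>\<^sub>0 T > - 1\<close>. As the slope runs from \<open>- 1 / T\<close> to \<open>0\<close>, the value of
  \<open>Q\<close> decreases from \<open>1\<close>, the limit as the control point recedes to infinity (lemma
  \<open>Q_value_at_endpoint\<close>). The bound assumed for \<open>Q\<^sub>0\<close> keeps it below this limit: it gives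
  \<open>Q\<^sub>0 \<le> 0\<close>, because \<open>\<bar>\<sigma>\<^sub>0\<bar> < \<pi> / 2\<close> gives \<open>w\<^sup>2 < 1\<close>.
\<close>

section \<open>The quartic equation for the slope\<close>

definition tan_profile :: "real \<Rightarrow> real" where
  "tan_profile t = (t^4 + 6 * t^2 - 3) / (8 * t)"

text \<open>
  The derivative is \<open>3 (1 + t\<^sup>2)\<^sup>2 / (8 t\<^sup>2) > 0\<close>; factoring the difference quotient gives the same
  conclusion on each half-line without calculus.
\<close>

lemma tan_profile_strict_mono:
  assumes "t * u > 0" "t < u"
  shows "tan_profile t < tan_profile u"
proof -
  have nz: "t \<noteq> 0" "u \<noteq> 0" using assms by auto
  have "tan_profile u - tan_profile t
      = (u - t) * ((t * u) * (t^2 + t * u + u^2) + 6 * (t * u) + 3) / (8 * (t * u))"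
    using nz by (simp add: tan_profile_def divide_simps) algebra
  moreover have "(t * u) * (t^2 + t * u + u^2) + 6 * (t * u) + 3 > 0"
  proof -
    have "t^2 + t * u + u^2 > 0"
      using assms(1) zero_le_power2[of t] zero_le_power2[of u] by linarith
    then have "(t * u) * (t^2 + t * u + u^2) > 0"
      using assms(1) by (rule mult_pos_pos[rotated])
    then show ?thesis using assms by linarith
  qed
  ultimately have "tan_profile u - tan_profile t > 0"
    using assms by (simp add: divide_pos_pos)
  then show ?thesis by simp
qed

lemma tan_profile_inject:
  assumes "t * c < 0" "u * c < 0" "tan_profile t = tan_profile u"
  shows "t = u"
proof -
  have "t * u > 0"
    using assms(1,2) by (auto simp: mult_less_0_iff intro: mult_pos_pos mult_neg_neg)
  then show ?thesis
    using tan_profile_strict_mono[of t u] tan_profile_strict_mono[of u t] assms(3)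
    by (cases t u rule: linorder_cases) (auto simp: mult.commute)
qed

text \<open>
  Ferrari's factorization of the quartic \<open>t\<^sup>4 + 6 t\<^sup>2 + 8 Q t - 3\<close> into two quadratics. The relations
  between \<open>m\<close>, \<open>n\<close> and \<open>r\<close> force \<open>m\<^sup>3 = 1 + Q\<^sup>2\<close>, the resolvent cubic.
\<close>

lemma tan_profile_root:
  fixes Q m n r r\<^sub>2 t :: real
  assumes "r^2 = m - 1" "n^2 = m^2 + m + 1" "r * n = Q"
    and "r\<^sub>2^2 = 2 * n - (m + 2)" "(t + r)^2 = r\<^sub>2^2" "t \<noteq> 0"
  shows "tan_profile t = - Q"
proof -
  have A: "t^2 + 2 * r * t + (2 * m + 1 - 2 * n) = 0"
    using assms(1,4,5) by (simp add: power2_sum) (simp add: algebra_simps)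
  have "t^4 + 6 * t^2 + 8 * Q * t - 3
      = (t^2 + 2 * r * t + (2 * m + 1 - 2 * n)) * (t^2 - 2 * r * t + (2 * m + 1 + 2 * n))"
    using assms(1-3) by algebra
  with A have "t^4 + 6 * t^2 + 8 * Q * t - 3 = 0" by simp
  then have "t^4 + 6 * t^2 - 3 = - Q * (8 * t)" by (simp add: algebra_simps)
  then show ?thesis using assms(6) by (simp add: tan_profile_def)
qed

section \<open>The curve of constant angle sum\<close>

text \<open>Both sides are the squared modulus of \<open>(1 + z) (1 - z) = 1 - z\<^sup>2\<close> for \<open>z = p + i q\<close>.\<close>

lemma h_mult_power2: "(h1 p q * h2 p q)^2 = (1 - p^2 + q^2)^2 + (2 * p * q)^2"
proof -
  have "(h1 p q)^2 = (1 + p)^2 + q^2" "(h2 p q)^2 = (1 - p)^2 + q^2"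
    by (simp_all add: h1_def h2_def)
  then show ?thesis unfolding power_mult_distrib[of "h1 p q" "h2 p q"] by algebra
qed

lemma h_pos:
  assumes "q \<noteq> 0"
  shows "h1 p q > 0" "h2 p q > 0"
  using assms by (simp_all add: h1_def h2_def sum_power2_gt_zero_iff)

text \<open>
  The angle sum is the argument of \<open>1 - z\<^sup>2\<close>. No multiple of \<open>2 \<pi>\<close> has to be subtracted, because the
  two tangent angles lie on opposite sides of the real axis.
\<close>

lemma arc_sigma_cos_sin:
  assumes "q \<noteq> 0"
  shows "\<bar>arc_sigma p q\<bar> < pi"
    and "cos (arc_sigma p q) * (h1 p q * h2 p q) = 1 - p^2 + q^2"
    and "sin (arc_sigma p q) * (h1 p q * h2 p q) = - 2 * p * q"
proof -
  define a b where "a = tangent_angle0 p q" and "b = tangent_angle1 p q"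
  have a: "- pi < a" "a < pi" "cos a * h1 p q = 1 + p" "sin a * h1 p q = q"
    using tangent_angle0_iff[OF assms, of a p] h_pos[OF assms, of p] by (auto simp: a_def)
  have b: "- pi < b" "b < pi" "cos b * h2 p q = 1 - p" "sin b * h2 p q = - q"
    using tangent_angle1_iff[OF assms, of b p] h_pos[OF assms, of p] by (auto simp: b_def)
  have s: "arc_sigma p q = a + b" by (simp add: arc_sigma_def a_def b_def)
  have sgn_sin: "x > 0 \<longleftrightarrow> sin x > 0" if "- pi < x" "x < pi" for x :: real
    using that sin_gt_zero[of x] sin_gt_zero[of "- x"] by (cases x "0::real" rule: linorder_cases) auto
  have "sin a > 0 \<longleftrightarrow> q > 0"
    using a(4) h_pos(1)[OF assms, of p] by (metis zero_less_mult_pos2 mult_pos_pos)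
  moreover have "sin b > 0 \<longleftrightarrow> - q > 0"
    using b(4) h_pos(2)[OF assms, of p] by (metis zero_less_mult_pos2 mult_pos_pos)
  ultimately have "a > 0 \<longleftrightarrow> \<not> b > 0"
    using sgn_sin a b assms by auto
  then show "\<bar>arc_sigma p q\<bar> < pi" using a b s by auto
  show "cos (arc_sigma p q) * (h1 p q * h2 p q) = 1 - p^2 + q^2"
    unfolding s cos_add using a(3,4) b(3,4) by algebra
  show "sin (arc_sigma p q) * (h1 p q * h2 p q) = - 2 * p * q"
    unfolding s sin_add using a(3,4) b(3,4) by algebra
qed

text \<open>
  The equation says that \<open>1 - z\<^sup>2\<close> lies on the real line spanned by \<open>exp (i \<sigma>)\<close>; the inequality
  selects the half of this line on which its argument is \<open>\<sigma>\<close> and not \<open>\<sigma> \<plusminus> \<pi>\<close>.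
\<close>

lemma arc_sigma_eq_iff:
  assumes "q \<noteq> 0" "0 < \<bar>\<sigma>\<bar>" "\<bar>\<sigma>\<bar> < pi"
  shows "arc_sigma p q = \<sigma> \<longleftrightarrow>
    p * q * sin \<sigma> < 0 \<and> (1 - p^2 + q^2) * sin \<sigma> = - 2 * p * q * cos \<sigma>"
proof -
  define s where "s = h1 p q * h2 p q"
  have s: "s > 0" using h_pos[OF assms(1)] by (simp add: s_def)
  note cs = arc_sigma_cos_sin[OF assms(1), of p, folded s_def]
  have sin_nz: "sin \<sigma> \<noteq> 0"
    using assms(2,3) sin_gt_zero[of \<sigma>] sin_gt_zero[of "- \<sigma>"]
    by (cases \<sigma> "0::real" rule: linorder_cases) auto
  show ?thesis
  proof
    assume "arc_sigma p q = \<sigma>"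
    with cs have c: "cos \<sigma> * s = 1 - p^2 + q^2" and si: "sin \<sigma> * s = - 2 * p * q" by auto
    have "2 * (p * q * sin \<sigma>) = - s * (sin \<sigma>)^2" using si by algebra
    moreover have "s * (sin \<sigma>)^2 > 0" using s sin_nz by simp
    ultimately have "p * q * sin \<sigma> < 0" by simp
    moreover have "(1 - p^2 + q^2) * sin \<sigma> = - 2 * p * q * cos \<sigma>"
      using c si by algebra
    ultimately show "p * q * sin \<sigma> < 0 \<and> (1 - p^2 + q^2) * sin \<sigma> = - 2 * p * q * cos \<sigma>" ..
  next
    assume *: "p * q * sin \<sigma> < 0 \<and> (1 - p^2 + q^2) * sin \<sigma> = - 2 * p * q * cos \<sigma>"
    define k where "k = - 2 * p * q / sin \<sigma>"
    have "k = - 2 * ((p * q * sin \<sigma>) / (sin \<sigma>)^2)"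
      using sin_nz by (simp add: k_def power2_eq_square)
    moreover have "(sin \<sigma>)^2 > 0" using sin_nz by simp
    ultimately have k: "k > 0" using * divide_neg_pos[of "p * q * sin \<sigma>" "(sin \<sigma>)^2"] by linarith
    have k1: "k * sin \<sigma> = - 2 * p * q" using sin_nz by (simp add: k_def)
    have k2: "k * cos \<sigma> = 1 - p^2 + q^2"
    proof -
      have "k * cos \<sigma> * sin \<sigma> = (1 - p^2 + q^2) * sin \<sigma>" using k1 * by algebra
      then show ?thesis using sin_nz by simp
    qed
    \<comment> \<open>Both are the modulus of \<open>1 - z\<^sup>2\<close>, so polar coordinates of \<open>1 - z\<^sup>2\<close> can be compared.\<close>
    have "k^2 = s^2"
      using k1 k2 sin_cos_squared_add[of \<sigma>] h_mult_power2[of p q] unfolding s_def by algebra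
    then have "k = s" using k s by (simp add: power2_eq_iff)
    then have "cos (arc_sigma p q) = cos \<sigma>" "sin (arc_sigma p q) = sin \<sigma>"
      using cs k1 k2 s by (metis mult.commute mult_cancel_left less_irrefl)+
    then obtain j :: int where j: "arc_sigma p q = \<sigma> + 2 * pi * of_int j"
      by (metis sin_cos_eq_iff)
    have "\<bar>2 * pi * of_int j\<bar> < 2 * pi" using j cs(1) assms(3) by linarith
    then have "\<bar>of_int j :: real\<bar> < 1" by (simp add: abs_mult)
    then have "j = 0" by linarith
    then show "arc_sigma p q = \<sigma>" using j by simp
  qed
qed

lemma sin_cos_half_tan:
  fixes \<sigma> :: real
  assumes "cos (\<sigma> / 2) \<noteq> 0"
  shows "sin \<sigma> = 2 * tan (\<sigma> / 2) / (1 + (tan (\<sigma> / 2))^2)"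
    and "cos \<sigma> = (1 - (tan (\<sigma> / 2))^2) / (1 + (tan (\<sigma> / 2))^2)"
  using sin_tan_half[of "\<sigma> / 2"] cos_tan_half[of "\<sigma> / 2"] assms by simp_all

lemma half_tan_facts:
  fixes \<sigma> :: real
  assumes "0 < \<bar>\<sigma>\<bar>" "\<bar>\<sigma>\<bar> < pi"
  shows "cos (\<sigma> / 2) \<noteq> 0" "tan (\<sigma> / 2) \<noteq> 0" "sgn (tan (\<sigma> / 2)) = sgn \<sigma>"
    and "arctan (tan (\<sigma> / 2)) = \<sigma> / 2"
proof -
  have "cos (\<sigma> / 2) > 0" using assms by (intro cos_gt_zero_pi) auto
  then show "cos (\<sigma> / 2) \<noteq> 0" by simp
  show at: "arctan (tan (\<sigma> / 2)) = \<sigma> / 2" using assms by (intro arctan_tan) auto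
  show "tan (\<sigma> / 2) \<noteq> 0" using at assms by auto
  show "sgn (tan (\<sigma> / 2)) = sgn \<sigma>"
    using at assms by (metis sgn_if arctan_less_zero_iff zero_less_arctan_iff half_gt_zero_iff
      divide_less_0_iff zero_less_numeral less_asym linorder_neqE_linordered_idom)
qed

text \<open>
  Substituting \<open>q = t p\<close> and the rational parametrization of \<open>sin \<sigma>\<close> and \<open>cos \<sigma>\<close> by \<open>T\<close> turns
  the equation of the curve into one for \<open>p\<^sup>2\<close> alone, whose coefficient factors.
\<close>

lemma arc_sigma_eq_iff_slope:
  assumes "p \<noteq> 0" "t \<noteq> 0" "0 < \<bar>\<sigma>\<bar>" "\<bar>\<sigma>\<bar> < pi"
  defines "T \<equiv> tan (\<sigma> / 2)"
  shows "arc_sigma p (t * p) = \<sigma> \<longleftrightarrow> t * T < 0 \<and> p^2 * ((1 + t * T) * (1 - t / T)) = 1"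
proof -
  note T = half_tan_facts[OF assms(3,4), folded T_def]
  have pos: "1 + T^2 > 0" by (simp add: add_pos_nonneg)
  have S: "sin \<sigma> = 2 * T / (1 + T^2)" and C: "cos \<sigma> = (1 - T^2) / (1 + T^2)"
    using sin_cos_half_tan[OF T(1)] by (simp_all add: T_def)
  have "p * (t * p) * sin \<sigma> = (t * T) * (2 * p^2 / (1 + T^2))"
    unfolding S by (simp add: power2_eq_square mult_ac)
  then have i: "p * (t * p) * sin \<sigma> < 0 \<longleftrightarrow> t * T < 0"
    using pos assms(1) by (simp add: mult_less_0_iff zero_less_divide_iff divide_less_0_iff)
  have "(1 - p^2 + (t * p)^2) * sin \<sigma> - (- 2 * p * (t * p) * cos \<sigma>)
      = 2 * T / (1 + T^2) * (1 - p^2 * ((1 + t * T) * (1 - t / T)))"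
    unfolding S C using pos T(2) by (simp add: divide_simps) algebra
  moreover have "2 * T / (1 + T^2) \<noteq> 0" using pos T(2) by simp
  ultimately have ii: "(1 - p^2 + (t * p)^2) * sin \<sigma> = - 2 * p * (t * p) * cos \<sigma>
      \<longleftrightarrow> p^2 * ((1 + t * T) * (1 - t / T)) = 1"
    by (metis eq_iff_diff_eq_0 mult_eq_0_iff)
  show ?thesis
    using arc_sigma_eq_iff[of "t * p" \<sigma> p] assms(1-4) i ii by simp
qed

section \<open>The function Q on the curve\<close>

text \<open>
  With \<open>s = \<bar>1 - z\<^sup>2\<bar>\<close> one has \<open>sin \<sigma> = - 2 p q / s\<close> and \<open>cos \<sigma> = (1 - p\<^sup>2 + q\<^sup>2) / s\<close>, so every term
  becomes a rational function of \<open>p\<close>, \<open>q\<close>, \<open>s\<close> over the common denominator \<open>s\<^sup>3\<close>. The identity is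
  then polynomial, because \<open>f2 \<sigma> - sin\<^sup>2 (\<sigma> / 2) = cos\<^sup>3 \<sigma> - cos \<sigma> = - cos \<sigma> sin\<^sup>2 \<sigma>\<close> is
  homogeneous of degree three in sine and cosine as well.
\<close>

lemma arc_Q_eq_tan_profile:
  assumes "q \<noteq> 0" "p \<noteq> 0" "arc_sigma p q = \<sigma>"
  shows "arc_Q p q = f2 \<sigma> - (sin \<sigma>)^3 * tan_profile (q / p)"
proof -
  define s where "s = h1 p q * h2 p q"
  have h: "h1 p q > 0" "h2 p q > 0" using h_pos[OF assms(1)] .
  then have s: "s > 0" by (simp add: s_def)
  have "sin \<sigma> * s = - 2 * p * q" "cos \<sigma> * s = 1 - p^2 + q^2"
    using arc_sigma_cos_sin(2,3)[OF assms(1), of p] assms(3) by (simp_all add: s_def)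
  then have S: "sin \<sigma> = - 2 * p * q / s" and C: "cos \<sigma> = (1 - p^2 + q^2) / s"
    by (simp_all only: nonzero_eq_divide_eq[OF less_imp_neq[OF s, symmetric]])
  have a: "curvature0 p q + sin (tangent_angle0 p q) = q * ((h1 p q)^2 - 1) / (h1 p q)^3"
    using tangent_angle0_iff[OF assms(1), of "tangent_angle0 p q" p] h
    by (simp add: curvature0_def field_simps power2_eq_square power3_eq_cube)
  have b: "curvature1 p q - sin (tangent_angle1 p q) = q * ((h2 p q)^2 - 1) / (h2 p q)^3"
    using tangent_angle1_iff[OF assms(1), of "tangent_angle1 p q" p] h
    by (simp add: curvature1_def field_simps power2_eq_square power3_eq_cube)
  have hh: "(h1 p q)^2 = (1 + p)^2 + q^2" "(h2 p q)^2 = (1 - p)^2 + q^2"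
    by (simp_all add: h1_def h2_def)
  have "(curvature0 p q + sin (tangent_angle0 p q)) * (curvature1 p q - sin (tangent_angle1 p q))
      = q^2 * (((1 + p)^2 + q^2 - 1) * ((1 - p)^2 + q^2 - 1)) / s^3"
    unfolding a b hh s_def by (simp add: power_mult_distrib power2_eq_square mult_ac)
  also have "((1 + p)^2 + q^2 - 1) * ((1 - p)^2 + q^2 - 1) = (p^2 + q^2)^2 - 4 * p^2"
    by algebra
  finally have prod: "(curvature0 p q + sin (tangent_angle0 p q))
      * (curvature1 p q - sin (tangent_angle1 p q)) = q^2 * ((p^2 + q^2)^2 - 4 * p^2) / s^3" .
  have half: "(sin (\<sigma> / 2))^2 = (1 - cos \<sigma>) / 2"
    using cos_double_sin[of "\<sigma> / 2"] by simp
  have prof: "(sin \<sigma>)^3 * tan_profile (q / p) = - (q^2 * (q^4 + 6 * p^2 * q^2 - 3 * p^4)) / s^3"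
    unfolding S tan_profile_def using assms(1,2) s
    by (simp add: divide_simps) algebra
  have CS: "(cos \<sigma>)^3 - cos \<sigma> = - ((1 - p^2 + q^2) * (4 * p^2 * q^2)) / s^3"
  proof -
    have "(cos \<sigma>)^3 - cos \<sigma> = - (cos \<sigma> * (sin \<sigma>)^2)"
      using sin_cos_squared_add[of \<sigma>] by algebra
    then show ?thesis
      unfolding S C using s by (simp add: field_simps power2_eq_square power3_eq_cube)
  qed
  have "arc_Q p q - (f2 \<sigma> - (sin \<sigma>)^3 * tan_profile (q / p))
      = q^2 * ((p^2 + q^2)^2 - 4 * p^2) / s^3 - ((cos \<sigma>)^3 - cos \<sigma>)
        + (sin \<sigma>)^3 * tan_profile (q / p)"
    unfolding arc_Q_def prod using assms(3) half
    by (simp add: arc_sigma_def f2_def)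
  also have "\<dots> = (q^2 * ((p^2 + q^2)^2 - 4 * p^2) + (1 - p^2 + q^2) * (4 * p^2 * q^2)
      - q^2 * (q^4 + 6 * p^2 * q^2 - 3 * p^4)) / s^3"
    unfolding CS prof by (simp add: diff_divide_distrib add_divide_distrib)
  also have "q^2 * ((p^2 + q^2)^2 - 4 * p^2) + (1 - p^2 + q^2) * (4 * p^2 * q^2)
      - q^2 * (q^4 + 6 * p^2 * q^2 - 3 * p^4) = 0"
    by algebra
  finally show ?thesis by simp
qed

text \<open>
  At the slope \<open>- 1 / T\<close> the factor \<open>1 + t T\<close> of the curve equation vanishes and the control point goes
  to infinity. There the curvatures tend to zero and both tangents become parallel, at the angle
  \<open>\<sigma> / 2 \<plusminus> \<pi> / 2\<close>, so \<open>Q\<close> tends to \<open>cos\<^sup>2 (\<sigma> / 2) + sin\<^sup>2 (\<sigma> / 2) = 1\<close>.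
\<close>

lemma Q_value_at_endpoint:
  assumes "0 < \<bar>\<sigma>\<bar>" "\<bar>\<sigma>\<bar> < pi"
  shows "f2 \<sigma> - (sin \<sigma>)^3 * tan_profile (- (1 / tan (\<sigma> / 2))) = 1"
proof -
  define T where "T = tan (\<sigma> / 2)"
  note T = half_tan_facts[OF assms, folded T_def]
  have pos: "1 + T^2 > 0" by (simp add: add_pos_nonneg)
  then have nz: "1 + T^2 \<noteq> 0" by simp
  have S: "sin \<sigma> = 2 * T / (1 + T^2)" and C: "cos \<sigma> = (1 - T^2) / (1 + T^2)"
    using sin_cos_half_tan[OF T(1)] by (simp_all add: T_def)
  have P: "tan_profile (- (1 / T)) = - (1 + 6 * T^2 - 3 * T^4) / (8 * T^3)"
    unfolding tan_profile_def using T(2) by (simp add: divide_simps) algebra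
  have "(sin \<sigma>)^3 * tan_profile (- (1 / T)) = - (1 + 6 * T^2 - 3 * T^4) / (1 + T^2)^3"
    unfolding P S using nz T(2) by (simp add: divide_simps)
  moreover have "f2 \<sigma> = (T^6 + 6 * T^4 - 3 * T^2) / (1 + T^2)^3"
    unfolding f2_def C using nz by (simp add: divide_simps) algebra
  moreover have "(T^6 + 6 * T^4 - 3 * T^2) + (1 + 6 * T^2 - 3 * T^4) = (1 + T^2)^3"
    by algebra
  ultimately have "f2 \<sigma> - (sin \<sigma>)^3 * tan_profile (- (1 / T)) = (1 + T^2)^3 / (1 + T^2)^3"
    by (simp add: diff_divide_distrib[symmetric] add_divide_distrib[symmetric])
  then show ?thesis unfolding T_def[symmetric] using nz by simp
qed

text \<open>
  By monotonicity of \<open>tan_profile\<close>, slopes beyond the endpoint \<open>- 1 / T\<close> would give values of at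
  least \<open>1\<close>. This makes the root of the quartic an admissible slope.
\<close>

lemma slope_above_endpoint:
  assumes "0 < \<bar>\<sigma>\<bar>" "\<bar>\<sigma>\<bar> < pi" "t * tan (\<sigma> / 2) < 0"
    and "f2 \<sigma> - (sin \<sigma>)^3 * tan_profile t < 1"
  shows "- 1 < t * tan (\<sigma> / 2)"
proof (rule ccontr)
  define T where "T = tan (\<sigma> / 2)"
  assume "\<not> - 1 < t * tan (\<sigma> / 2)"
  then have le: "t * T \<le> - 1" by (simp add: T_def)
  note T = half_tan_facts[OF assms(1,2), folded T_def]
  have lt: "(sin \<sigma>)^3 * tan_profile (- (1 / T)) < (sin \<sigma>)^3 * tan_profile t"
    using Q_value_at_endpoint[OF assms(1,2)] assms(4) by (simp add: T_def)
  have S: "sin \<sigma> = 2 * T / (1 + T^2)"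
    using sin_cos_half_tan[OF T(1)] by (simp add: T_def)
  have pos: "1 + T^2 > 0" by (simp add: add_pos_nonneg)
  show False
  proof (cases "T > 0")
    case True
    then have s: "(sin \<sigma>)^3 > 0" unfolding S using pos by simp
    have "t \<le> - (1 / T)" using le True by (simp add: field_simps)
    moreover have "t * (- (1 / T)) > 0" using True calculation by (intro mult_neg_neg) (auto intro: le_less_trans)
    ultimately have "tan_profile t \<le> tan_profile (- (1 / T))"
      using tan_profile_strict_mono[of t "- (1 / T)"] by (cases "t = - (1 / T)") auto
    then show False using lt s by simp
  next
    case False
    then have Tn: "T < 0" using T(2) by simp
    then have s: "(sin \<sigma>)^3 < 0" unfolding S using pos by (simp add: divide_neg_pos)
    have "- (1 / T) \<le> t" using le Tn by (simp add: field_simps)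
    moreover have "0 < - (1 / T)" using Tn by simp
    ultimately have "- (1 / T) \<le> t" "- (1 / T) * t > 0"
      by (blast intro: mult_pos_pos less_le_trans)+
    then have "tan_profile (- (1 / T)) \<le> tan_profile t"
      using tan_profile_strict_mono[of "- (1 / T)" t] by (cases "t = - (1 / T)") auto
    then show False using lt s by simp
  qed
qed

section \<open>Admissible polar angles\<close>

text \<open>
  The radius \<open>rho\<close> solves the curve equation, since
  \<open>sin (\<sigma> - 2 \<xi>) = sin \<sigma> cos\<^sup>2 \<xi> (1 + t T) (1 - t / T)\<close> for \<open>t = tan \<xi>\<close>. The bounds on \<open>t T\<close> make
  the square root in \<open>rho\<close> a root of a positive number.
\<close>

lemma polar_point_power2:
  assumes "0 < \<bar>\<sigma>\<bar>" "\<bar>\<sigma>\<bar> < pi" "cos \<xi> \<noteq> 0"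
  defines "T \<equiv> tan (\<sigma> / 2)"
  assumes "- 1 < tan \<xi> * T" "tan \<xi> * T < 0"
  shows "(rho \<sigma> \<xi> * cos \<xi>)^2 * ((1 + tan \<xi> * T) * (1 - tan \<xi> / T)) = 1"
proof -
  define t where "t = tan \<xi>"
  note T = half_tan_facts[OF assms(1,2), folded T_def]
  have pos: "1 + T^2 > 0" by (simp add: add_pos_nonneg)
  have S: "sin \<sigma> = 2 * T / (1 + T^2)" and C: "cos \<sigma> = (1 - T^2) / (1 + T^2)"
    using sin_cos_half_tan[OF T(1)] by (simp_all add: T_def)
  have sx: "sin \<xi> = t * cos \<xi>" using assms(3) by (simp add: t_def tan_def)
  have "t / T = t * T / T^2" using T(2) by (simp add: power2_eq_square)
  then have "t / T < 0" using assms(6) T(2) by (simp add: t_def divide_neg_pos)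
  then have k: "(1 + t * T) * (1 - t / T) > 0" using assms(5) by (simp add: t_def)
  have "sin (\<sigma> - 2 * \<xi>) = sin \<sigma> * ((cos \<xi>)^2 * ((1 + t * T) * (1 - t / T)))"
    unfolding sin_diff sin_double cos_double S C sx
    using pos T(2) by (simp add: divide_simps) algebra
  moreover have "sin \<sigma> \<noteq> 0" unfolding S using pos T(2) by simp
  ultimately have "(rho \<sigma> \<xi>)^2 = 1 / ((cos \<xi>)^2 * ((1 + t * T) * (1 - t / T)))"
    unfolding rho_def using k by simp
  then have "(rho \<sigma> \<xi> * cos \<xi>)^2 = 1 / ((1 + t * T) * (1 - t / T))"
    using assms(3) by (simp add: power_mult_distrib)
  then show ?thesis
    unfolding t_def[symmetric] using k by (metis nonzero_eq_divide_eq less_irrefl)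
qed

lemma eq_arctan_tan_mod_pi:
  assumes "cos \<xi> \<noteq> 0"
  shows "\<exists>j::int. \<xi> = arctan (tan \<xi>) + pi * of_int j"
proof -
  have "sin (\<xi> - arctan (tan \<xi>)) = 0"
    unfolding sin_diff using assms by (simp add: sin_arctan cos_arctan tan_def field_simps)
  then obtain j :: int where "\<xi> - arctan (tan \<xi>) = of_int j * pi"
    using sin_zero_iff_int2 by blast
  then have "\<xi> = arctan (tan \<xi>) + pi * of_int j" by (simp add: algebra_simps)
  then show ?thesis ..
qed

lemma tan_arctan_mod_pi:
  "cos (arctan t + pi * of_int j) \<noteq> 0" "tan (arctan t + pi * of_int j) = t"
proof -
  have s: "sin (pi * of_int j) = 0" by (metis sin_zero_iff_int2 mult.commute)
  then have c: "cos (pi * of_int j) \<noteq> 0" using sin_zero_abs_cos_one by fastforce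
  show "cos (arctan t + pi * of_int j) \<noteq> 0"
    using s c by (simp add: cos_add)
  show "tan (arctan t + pi * of_int j) = t"
    using s c tan_arctan[of t] by (simp add: tan_def cos_add sin_add)
qed

lemma mod_two_pi_pair:
  fixes x y :: real
  shows "(\<exists>k::int. x = y + 2 * pi * of_int k \<or> x = y + pi + 2 * pi * of_int k)
    \<longleftrightarrow> (\<exists>j::int. x = y + pi * of_int j)"
proof
  assume "\<exists>k::int. x = y + 2 * pi * of_int k \<or> x = y + pi + 2 * pi * of_int k"
  then obtain k :: int where "x = y + pi * of_int (2 * k) \<or> x = y + pi * of_int (2 * k + 1)"
    by (auto simp: algebra_simps)
  then show "\<exists>j::int. x = y + pi * of_int j" by blast
next
  assume "\<exists>j::int. x = y + pi * of_int j"
  then obtain j :: int where j: "x = y + pi * of_int j" ..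
  show "\<exists>k::int. x = y + 2 * pi * of_int k \<or> x = y + pi + 2 * pi * of_int k"
  proof (cases "even j")
    case True
    then show ?thesis using j by (auto elim!: evenE)
  next
    case False
    then show ?thesis using j by (auto elim!: oddE simp: algebra_simps)
  qed
qed

text \<open>
  The two intervals that describe admissible angles modulo \<open>2 \<pi>\<close> differ by \<open>\<pi>\<close>. One of them lies in
  the range of \<open>arctan\<close>, so modulo \<open>\<pi>\<close> it suffices to keep that one.
\<close>

definition principal_angles :: "real \<Rightarrow> real set" where
  "principal_angles \<sigma> = (if \<sigma> > 0 then {\<sigma> / 2 - pi / 2 <..< 0} else {0 <..< pi / 2 + \<sigma> / 2})"

lemma admissible_iff_principal:
  assumes "\<sigma> \<noteq> 0"
  shows "admissible \<sigma> \<xi> \<longleftrightarrow> (\<exists>\<eta>\<in>principal_angles \<sigma>. \<exists>j::int. \<xi> = \<eta> + pi * of_int j)"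
proof -
  have base: "x \<in> base_angles \<sigma> \<longleftrightarrow>
      x \<in> principal_angles \<sigma> \<or> x - pi * sgn \<sigma> \<in> principal_angles \<sigma>" for x
    using assms by (auto simp: base_angles_def principal_angles_def sgn_if)
  show ?thesis
  proof
    assume "admissible \<sigma> \<xi>"
    then obtain k :: int where k: "\<xi> + 2 * pi * of_int k \<in> base_angles \<sigma>"
      unfolding admissible_def ..
    define j :: int where "j = (if \<sigma> > 0 then 1 else - 1)"
    have sg: "sgn \<sigma> = of_int j" using assms by (simp add: j_def sgn_if)
    have "\<xi> = (\<xi> + 2 * pi * of_int k) + pi * of_int (- 2 * k)"
      "\<xi> = (\<xi> + 2 * pi * of_int k - pi * sgn \<sigma>) + pi * of_int (j - 2 * k)"
      unfolding sg by (simp_all add: algebra_simps)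
    with k base show "\<exists>\<eta>\<in>principal_angles \<sigma>. \<exists>j::int. \<xi> = \<eta> + pi * of_int j" by blast
  next
    assume "\<exists>\<eta>\<in>principal_angles \<sigma>. \<exists>j::int. \<xi> = \<eta> + pi * of_int j"
    then obtain \<eta> and j :: int where e: "\<eta> \<in> principal_angles \<sigma>" "\<xi> = \<eta> + pi * of_int j"
      by blast
    show "admissible \<sigma> \<xi>"
    proof (cases "even j")
      case True
      then obtain i where "j = 2 * i" by (elim evenE)
      then have "\<xi> + 2 * pi * of_int (- i) = \<eta>" using e by simp
      then show ?thesis using e base unfolding admissible_def by metis
    next
      case False
      then obtain i where i: "j = 2 * i + 1" by (elim oddE)
      \<comment> \<open>The second interval is the first one shifted by \<open>\<pi>\<close> if \<open>\<sigma> > 0\<close> and by \<open>- \<pi>\<close> otherwise.\<close>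
      define l :: int where "l = (if \<sigma> > 0 then - i else - i - 1)"
      have "\<xi> + 2 * pi * of_int l - pi * sgn \<sigma> = \<eta>"
        using e i assms by (simp add: l_def sgn_if algebra_simps)
      then show ?thesis using e base unfolding admissible_def by metis
    qed
  qed
qed

lemma arctan_in_principal_iff:
  assumes "0 < \<bar>\<sigma>\<bar>" "\<bar>\<sigma>\<bar> < pi"
  shows "arctan t \<in> principal_angles \<sigma> \<longleftrightarrow> - 1 < t * tan (\<sigma> / 2) \<and> t * tan (\<sigma> / 2) < 0"
proof -
  define T where "T = tan (\<sigma> / 2)"
  note T = half_tan_facts[OF assms, folded T_def]
  \<comment> \<open>The endpoint of the interval other than 0 is the angle of slope \<open>- 1 / T\<close>.\<close>
  have inv: "arctan (- (1 / T)) = \<sigma> / 2 - sgn \<sigma> * pi / 2"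
    using Transcendental.arctan_inverse[of T] T by (simp add: arctan_minus)
  show ?thesis unfolding T_def[symmetric]
  proof (cases "\<sigma> > 0")
    case True
    then have Tp: "T > 0" using T(3) by (simp add: sgn_if split: if_splits)
    have "arctan t \<in> principal_angles \<sigma> \<longleftrightarrow> arctan (- (1 / T)) < arctan t \<and> arctan t < 0"
      using True inv by (simp add: principal_angles_def)
    also have "\<dots> \<longleftrightarrow> - (1 / T) < t \<and> t < 0" by (simp only: arctan_less_iff arctan_less_zero_iff)
    finally show "arctan t \<in> principal_angles \<sigma> \<longleftrightarrow> - 1 < t * T \<and> t * T < 0"
      using Tp by (simp add: mult_less_0_iff field_simps)
  next
    case False
    then have neg: "\<sigma> < 0" using assms by simp
    then have Tp: "T < 0" using T(3) by (simp add: sgn_if split: if_splits)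
    have "arctan t \<in> principal_angles \<sigma> \<longleftrightarrow> 0 < arctan t \<and> arctan t < arctan (- (1 / T))"
      using neg inv by (simp add: principal_angles_def add.commute)
    also have "\<dots> \<longleftrightarrow> 0 < t \<and> t < - (1 / T)" by (simp only: arctan_less_iff zero_less_arctan_iff)
    finally show "arctan t \<in> principal_angles \<sigma> \<longleftrightarrow> - 1 < t * T \<and> t * T < 0"
      using Tp by (auto simp add: mult_less_0_iff field_simps)
  qed
qed

lemma admissible_iff_tan:
  assumes "0 < \<bar>\<sigma>\<bar>" "\<bar>\<sigma>\<bar> < pi"
  shows "admissible \<sigma> \<xi> \<longleftrightarrow>
    cos \<xi> \<noteq> 0 \<and> - 1 < tan \<xi> * tan (\<sigma> / 2) \<and> tan \<xi> * tan (\<sigma> / 2) < 0"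
proof
  assume "admissible \<sigma> \<xi>"
  then obtain \<eta> and j :: int where e: "\<eta> \<in> principal_angles \<sigma>" "\<xi> = \<eta> + pi * of_int j"
    using admissible_iff_principal assms by fastforce
  have "\<bar>\<eta>\<bar> < pi / 2"
    using e(1) assms by (auto simp: principal_angles_def split: if_splits)
  then have "\<eta> = arctan (tan \<eta>)" by (intro arctan_tan[symmetric]) auto
  then show "cos \<xi> \<noteq> 0 \<and> - 1 < tan \<xi> * tan (\<sigma> / 2) \<and> tan \<xi> * tan (\<sigma> / 2) < 0"
    using e tan_arctan_mod_pi[of "tan \<eta>" j] arctan_in_principal_iff[OF assms, of "tan \<eta>"] by simp
next
  assume *: "cos \<xi> \<noteq> 0 \<and> - 1 < tan \<xi> * tan (\<sigma> / 2) \<and> tan \<xi> * tan (\<sigma> / 2) < 0"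
  then have "arctan (tan \<xi>) \<in> principal_angles \<sigma>"
    using arctan_in_principal_iff[OF assms] by blast
  then show "admissible \<sigma> \<xi>"
    using eq_arctan_tan_mod_pi[of \<xi>] * admissible_iff_principal[of \<sigma> \<xi>] assms by fastforce
qed

lemma admissible_polar_point:
  assumes "0 < \<bar>\<sigma>\<bar>" "\<bar>\<sigma>\<bar> < pi" "admissible \<sigma> \<xi>"
  defines "p \<equiv> rho \<sigma> \<xi> * cos \<xi>"
  shows "p \<noteq> 0" "polar_point \<sigma> \<xi> = (p, tan \<xi> * p)" "arc_sigma p (tan \<xi> * p) = \<sigma>"
proof -
  note ad = admissible_iff_tan[OF assms(1,2), THEN iffD1, OF assms(3)]
  have sq: "p^2 * ((1 + tan \<xi> * tan (\<sigma> / 2)) * (1 - tan \<xi> / tan (\<sigma> / 2))) = 1"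
    unfolding p_def using polar_point_power2[OF assms(1,2)] ad by blast
  then show p: "p \<noteq> 0" by auto
  show "polar_point \<sigma> \<xi> = (p, tan \<xi> * p)"
    using ad by (simp add: polar_point_def p_def tan_def)
  show "arc_sigma p (tan \<xi> * p) = \<sigma>"
    using arc_sigma_eq_iff_slope[OF p _ assms(1,2), of "tan \<xi>"] ad sq
    by (cases "tan \<xi> = 0") auto
qed

lemma Q_polar_eq_tan_profile:
  assumes "0 < \<bar>\<sigma>\<bar>" "\<bar>\<sigma>\<bar> < pi" "admissible \<sigma> \<xi>"
  shows "Q_polar \<sigma> \<xi> = f2 \<sigma> - (sin \<sigma>)^3 * tan_profile (tan \<xi>)"
proof -
  note ad = admissible_polar_point[OF assms]
  have "tan \<xi> \<noteq> 0" using admissible_iff_tan[OF assms(1,2)] assms(3) by auto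
  then show ?thesis
    unfolding Q_polar_def ad(2) using arc_Q_eq_tan_profile[OF _ ad(1,3)] ad(1) by simp
qed

section \<open>Control points with prescribed Q\<close>

theorem proposition5:
  fixes \<sigma>\<^sub>0 Q\<^sub>0 w Q\<^sub>1 m n r\<^sub>1 r\<^sub>2 r\<^sub>12 \<theta>\<^sub>0 \<xi>\<^sub>0 \<xi>\<^sub>0' p\<^sub>1 q\<^sub>1 p\<^sub>2 q\<^sub>2 :: real
  assumes sigma0: "0 < \<bar>\<sigma>\<^sub>0\<bar>" "\<bar>\<sigma>\<^sub>0\<bar> < pi / 2"
    and w: "w = root 3 (tan (\<sigma>\<^sub>0 / 2))"
    and Q0: "Q\<^sub>0 \<le> - (w^6 * (w^2 + 2) / ((1 - w^2) * (w^2 + 1)^3))"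
    and Q1: "Q\<^sub>1 = (Q\<^sub>0 - f2 \<sigma>\<^sub>0) / (sin \<sigma>\<^sub>0)^3"
    and m: "m = root 3 (1 + Q\<^sub>1^2)"
    and n: "n = sqrt (m^2 + m + 1)"
    and r1: "r\<^sub>1 = sqrt (m - 1)"
    and r2: "r\<^sub>2 = sqrt (2 * n - (m + 2))"
    and r12: "r\<^sub>12 = 2 * n - (2 * m + 1)"
    and theta0: "\<theta>\<^sub>0 = - r\<^sub>1 * sgn Q\<^sub>1 - r\<^sub>2 * sgn \<sigma>\<^sub>0"
    and xi0: "\<xi>\<^sub>0 = arctan \<theta>\<^sub>0"
    and xi0': "\<xi>\<^sub>0' = \<xi>\<^sub>0 + pi"
    and pq1: "p\<^sub>1 = rho \<sigma>\<^sub>0 \<xi>\<^sub>0 * cos \<xi>\<^sub>0" "q\<^sub>1 = rho \<sigma>\<^sub>0 \<xi>\<^sub>0 * sin \<xi>\<^sub>0"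
    and pq2: "p\<^sub>2 = - p\<^sub>1" "q\<^sub>2 = - q\<^sub>1"
  shows "r\<^sub>12 = r\<^sub>2^2 - r\<^sub>1^2
    \<and> \<theta>\<^sub>0 = (if \<sigma>\<^sub>0 * Q\<^sub>1 < 0 then - (r\<^sub>12 / (r\<^sub>1 + r\<^sub>2)) * sgn \<sigma>\<^sub>0 else - (r\<^sub>1 + r\<^sub>2) * sgn \<sigma>\<^sub>0)
    \<and> {\<xi>. admissible \<sigma>\<^sub>0 \<xi> \<and> Q_polar \<sigma>\<^sub>0 \<xi> = Q\<^sub>0} =
        {\<xi>. \<exists>k::int. \<xi> = \<xi>\<^sub>0 + 2 * pi * of_int k \<or> \<xi> = \<xi>\<^sub>0' + 2 * pi * of_int k}
    \<and> polar_point \<sigma>\<^sub>0 \<xi>\<^sub>0 = (p\<^sub>1, q\<^sub>1) \<and> polar_point \<sigma>\<^sub>0 \<xi>\<^sub>0' = (p\<^sub>2, q\<^sub>2)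
    \<and> {(p, q). q \<noteq> 0 \<and> arc_sigma p q = \<sigma>\<^sub>0 \<and> arc_Q p q = Q\<^sub>0} = {(p\<^sub>1, q\<^sub>1), (p\<^sub>2, q\<^sub>2)}"
proof -
  have sig: "0 < \<bar>\<sigma>\<^sub>0\<bar>" "\<bar>\<sigma>\<^sub>0\<bar> < pi" using sigma0 pi_gt_zero by linarith+
  define T where "T = tan (\<sigma>\<^sub>0 / 2)"
  note T = half_tan_facts[OF sig, folded T_def]
  have sin_nz: "sin \<sigma>\<^sub>0 \<noteq> 0"
    using sin_cos_half_tan(1)[OF T(1)] T(2) by (simp add: T_def add_pos_nonneg less_imp_neq[symmetric])

  have "Q\<^sub>0 \<le> 0"
  proof -
    have "arctan (- 1) < arctan T" "arctan T < arctan 1"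
      unfolding T(4) arctan_minus arctan_one using sigma0 by linarith+
    then have "\<bar>T\<bar> < 1" by (simp only: arctan_less_iff)
    then have "\<bar>w\<bar> < 1" by (simp add: w T_def flip: real_root_abs)
    then have "w^2 < 1" by (simp add: abs_square_less_1)
    then have "w^6 * (w^2 + 2) / ((1 - w^2) * (w^2 + 1)^3) \<ge> 0"
      by (intro divide_nonneg_nonneg mult_nonneg_nonneg) auto
    then show ?thesis using Q0 by linarith
  qed

  have m1: "m \<ge> 1" by (simp add: m)
  have m3: "m^3 = 1 + Q\<^sub>1^2" by (simp add: m odd_real_root_pow)
  have n2: "n^2 = m^2 + m + 1" and n0: "n \<ge> 0"
    using m1 by (simp_all add: n)
  \<comment> \<open>\<open>4 n\<^sup>2 - (2 m + 1)\<^sup>2 = 3\<close>; this inequality is \<open>r\<^sub>1\<^sup>2 < r\<^sub>2\<^sup>2\<close>, which decides the sign of \<open>\<theta>\<^sub>0\<close>.\<close>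
  have n_m: "2 * m + 1 < 2 * n"
    by (rule power2_less_imp_less) (use n2 n0 m1 in \<open>auto simp: power2_eq_square algebra_simps\<close>)
  have r1s: "r\<^sub>1^2 = m - 1" and r10: "r\<^sub>1 \<ge> 0" using m1 by (simp_all add: r1)
  have r2s: "r\<^sub>2^2 = 2 * n - (m + 2)" and r20: "r\<^sub>2 \<ge> 0" using m1 n_m by (simp_all add: r2)
  have r1_less_r2: "r\<^sub>1 < r\<^sub>2"
    by (rule power2_less_imp_less) (use r1s r2s r20 n_m in auto)
  have r12_eq: "r\<^sub>12 = r\<^sub>2^2 - r\<^sub>1^2" by (simp add: r12 r1s r2s)

  \<comment> \<open>The signed root of \<open>m - 1\<close> required by Ferrari's factorization, where \<open>r n = Q\<^sub>1\<close>.\<close>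
  define r where "r = r\<^sub>1 * sgn Q\<^sub>1"
  have r1n: "r\<^sub>1 * n = \<bar>Q\<^sub>1\<bar>"
  proof (rule power2_eq_imp_eq)
    show "(r\<^sub>1 * n)^2 = \<bar>Q\<^sub>1\<bar>^2"
      unfolding power_mult_distrib r1s n2 power2_abs using m3 by algebra
  qed (use r10 n0 in auto)
  then have rn: "r * n = Q\<^sub>1" by (simp add: r_def sgn_if split: if_splits)
  have rs: "r^2 = m - 1"
  proof (cases "Q\<^sub>1 = 0")
    case True
    then show ?thesis by (simp add: r_def m)
  next
    case False
    then show ?thesis using r1s by (simp add: r_def power_mult_distrib sgn_if)
  qed

  have s_sgn: "sgn \<sigma>\<^sub>0 = 1 \<or> sgn \<sigma>\<^sub>0 = - 1" using sig by (auto simp: sgn_if)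
  have theta_r: "\<theta>\<^sub>0 = - r - r\<^sub>2 * sgn \<sigma>\<^sub>0" by (simp add: theta0 r_def)
  have theta_neg: "\<theta>\<^sub>0 * sgn \<sigma>\<^sub>0 < 0"
  proof -
    have "\<bar>r\<bar> < r\<^sub>2" using r1_less_r2 r10 by (auto simp: r_def sgn_if)
    then show ?thesis using s_sgn by (auto simp: theta_r)
  qed
  have thetaT: "\<theta>\<^sub>0 * T < 0"
    using theta_neg unfolding T(3)[symmetric] by (auto simp: sgn_if mult_less_0_iff split: if_splits)
  have root: "tan_profile \<theta>\<^sub>0 = - Q\<^sub>1"
  proof (rule tan_profile_root[OF rs n2 rn r2s])
    show "(\<theta>\<^sub>0 + r)^2 = r\<^sub>2^2" using s_sgn by (auto simp: theta_r)
    show "\<theta>\<^sub>0 \<noteq> 0" using theta_neg by auto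
  qed
  have value0: "f2 \<sigma>\<^sub>0 - (sin \<sigma>\<^sub>0)^3 * tan_profile \<theta>\<^sub>0 = Q\<^sub>0"
    unfolding root Q1 using sin_nz by simp
  have thetaT1: "- 1 < \<theta>\<^sub>0 * T"
    using slope_above_endpoint[OF sig, of \<theta>\<^sub>0] thetaT value0 \<open>Q\<^sub>0 \<le> 0\<close> by (simp add: T_def)
  have unique: "f2 \<sigma>\<^sub>0 - (sin \<sigma>\<^sub>0)^3 * tan_profile t = Q\<^sub>0 \<longleftrightarrow> t = \<theta>\<^sub>0" if "t * T < 0" for t
  proof
    assume "f2 \<sigma>\<^sub>0 - (sin \<sigma>\<^sub>0)^3 * tan_profile t = Q\<^sub>0"
    then have "(sin \<sigma>\<^sub>0)^3 * tan_profile t = (sin \<sigma>\<^sub>0)^3 * tan_profile \<theta>\<^sub>0"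
      using value0 by linarith
    then have "tan_profile t = tan_profile \<theta>\<^sub>0" using sin_nz by simp
    then show "t = \<theta>\<^sub>0" using tan_profile_inject that thetaT by blast
  qed (use value0 in simp)

  have cases_eq: "\<theta>\<^sub>0 = (if \<sigma>\<^sub>0 * Q\<^sub>1 < 0 then - (r\<^sub>12 / (r\<^sub>1 + r\<^sub>2)) * sgn \<sigma>\<^sub>0
      else - (r\<^sub>1 + r\<^sub>2) * sgn \<sigma>\<^sub>0)"
  proof -
    have quot: "r\<^sub>12 / (r\<^sub>1 + r\<^sub>2) = r\<^sub>2 - r\<^sub>1"
    proof -
      have "r\<^sub>12 = (r\<^sub>2 - r\<^sub>1) * (r\<^sub>1 + r\<^sub>2)" unfolding r12_eq by algebra
      moreover have "r\<^sub>1 + r\<^sub>2 \<noteq> 0" using r10 r1_less_r2 by linarith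
      ultimately show ?thesis by simp
    qed
    have "r\<^sub>1 = 0" if "Q\<^sub>1 = 0" using that by (simp add: r1 m)
    then show ?thesis
      unfolding quot theta0 using sig
      by (cases Q\<^sub>1 "0::real" rule: linorder_cases)
        (auto simp: sgn_if mult_less_0_iff algebra_simps)
  qed

  have xi: "\<xi> = \<xi>\<^sub>0 + pi * of_int j \<Longrightarrow> cos \<xi> \<noteq> 0 \<and> tan \<xi> = \<theta>\<^sub>0" for \<xi> and j :: int
    using tan_arctan_mod_pi[of \<theta>\<^sub>0 j] by (simp add: xi0)
  have angle_iff: "admissible \<sigma>\<^sub>0 \<xi> \<and> Q_polar \<sigma>\<^sub>0 \<xi> = Q\<^sub>0 \<longleftrightarrow>
      (\<exists>j::int. \<xi> = \<xi>\<^sub>0 + pi * of_int j)" for \<xi>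
  proof
    assume a: "admissible \<sigma>\<^sub>0 \<xi> \<and> Q_polar \<sigma>\<^sub>0 \<xi> = Q\<^sub>0"
    then have "cos \<xi> \<noteq> 0" "tan \<xi> * T < 0"
      using admissible_iff_tan[OF sig] by (auto simp: T_def)
    moreover have "f2 \<sigma>\<^sub>0 - (sin \<sigma>\<^sub>0)^3 * tan_profile (tan \<xi>) = Q\<^sub>0"
      using a Q_polar_eq_tan_profile[OF sig] by metis
    ultimately have "cos \<xi> \<noteq> 0" "tan \<xi> = \<theta>\<^sub>0" using unique by auto
    then show "\<exists>j::int. \<xi> = \<xi>\<^sub>0 + pi * of_int j"
      using eq_arctan_tan_mod_pi[of \<xi>] by (simp add: xi0)
  next
    assume "\<exists>j::int. \<xi> = \<xi>\<^sub>0 + pi * of_int j"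
    then have *: "cos \<xi> \<noteq> 0" "tan \<xi> = \<theta>\<^sub>0" using xi by blast+
    then have "admissible \<sigma>\<^sub>0 \<xi>"
      using admissible_iff_tan[OF sig] thetaT thetaT1 by (simp add: T_def)
    then show "admissible \<sigma>\<^sub>0 \<xi> \<and> Q_polar \<sigma>\<^sub>0 \<xi> = Q\<^sub>0"
      using Q_polar_eq_tan_profile[OF sig] value0 * by metis
  qed
  have angles: "{\<xi>. admissible \<sigma>\<^sub>0 \<xi> \<and> Q_polar \<sigma>\<^sub>0 \<xi> = Q\<^sub>0} =
      {\<xi>. \<exists>k::int. \<xi> = \<xi>\<^sub>0 + 2 * pi * of_int k \<or> \<xi> = \<xi>\<^sub>0' + 2 * pi * of_int k}"
    unfolding angle_iff xi0' mod_two_pi_pair ..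

  have polar: "polar_point \<sigma>\<^sub>0 \<xi>\<^sub>0 = (p\<^sub>1, q\<^sub>1)" by (simp add: polar_point_def pq1)
  have polar': "polar_point \<sigma>\<^sub>0 \<xi>\<^sub>0' = (p\<^sub>2, q\<^sub>2)"
  proof -
    have "sin (\<sigma>\<^sub>0 - 2 * (\<xi>\<^sub>0 + pi)) = sin (\<sigma>\<^sub>0 - 2 * \<xi>\<^sub>0)"
      using sin_periodic[of "\<sigma>\<^sub>0 - 2 * (\<xi>\<^sub>0 + pi)"] by (simp add: algebra_simps)
    then show ?thesis by (simp add: polar_point_def rho_def xi0' pq1 pq2)
  qed

  have tan_xi0: "tan \<xi>\<^sub>0 = \<theta>\<^sub>0" using xi[of \<xi>\<^sub>0 0] by simp
  have "admissible \<sigma>\<^sub>0 \<xi>\<^sub>0" using angle_iff[of \<xi>\<^sub>0] by (metis add.right_neutral mult_zero_right of_int_0)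
  note ad = admissible_polar_point[OF sig this, folded pq1, unfolded tan_xi0]
  have q1: "q\<^sub>1 = \<theta>\<^sub>0 * p\<^sub>1" using ad(2) polar by simp
  have theta_nz: "\<theta>\<^sub>0 \<noteq> 0" using thetaT by auto
  have locus: "arc_sigma p (t * p) = \<sigma>\<^sub>0 \<longleftrightarrow> t * T < 0 \<and> p^2 * ((1 + t * T) * (1 - t / T)) = 1"
    if "p \<noteq> 0" "t \<noteq> 0" for p t
    using arc_sigma_eq_iff_slope[OF that sig] by (simp add: T_def)
  \<comment> \<open>Once the slope is \<open>\<theta>\<^sub>0\<close>, the curve equation reads \<open>p\<^sup>2 K = 1\<close> and leaves only the sign of \<open>p\<close> open.\<close>
  define K where "K = (1 + \<theta>\<^sub>0 * T) * (1 - \<theta>\<^sub>0 / T)"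
  have K: "p\<^sub>1^2 * K = 1" using locus[OF ad(1) theta_nz] ad(3) by (simp add: K_def)
  have point_iff: "q \<noteq> 0 \<and> arc_sigma p q = \<sigma>\<^sub>0 \<and> arc_Q p q = Q\<^sub>0 \<longleftrightarrow> q = \<theta>\<^sub>0 * p \<and> p^2 = p\<^sub>1^2" for p q
  proof
    assume a: "q \<noteq> 0 \<and> arc_sigma p q = \<sigma>\<^sub>0 \<and> arc_Q p q = Q\<^sub>0"
    have p: "p \<noteq> 0" using arc_sigma_eq_iff[of q \<sigma>\<^sub>0 p] a sig by auto
    define t where "t = q / p"
    have t: "q = t * p" "t \<noteq> 0" using p a by (simp_all add: t_def)
    have l: "t * T < 0" "p^2 * ((1 + t * T) * (1 - t / T)) = 1"
      using locus[OF p t(2)] a t(1) by auto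
    have "t = \<theta>\<^sub>0"
      using unique[OF l(1)] arc_Q_eq_tan_profile[of q p \<sigma>\<^sub>0] a p by (simp add: t_def)
    with l(2) have "p^2 * K = p\<^sub>1^2 * K" using K by (simp add: K_def)
    moreover have "K \<noteq> 0" using K by auto
    ultimately have "p^2 = p\<^sub>1^2" using mult_right_cancel[of K] by blast
    then show "q = \<theta>\<^sub>0 * p \<and> p^2 = p\<^sub>1^2" using t(1) \<open>t = \<theta>\<^sub>0\<close> by simp
  next
    assume a: "q = \<theta>\<^sub>0 * p \<and> p^2 = p\<^sub>1^2"
    then have p: "p \<noteq> 0" using ad(1) by auto
    then have s: "arc_sigma p q = \<sigma>\<^sub>0"
      using locus[OF p theta_nz] thetaT K a by (simp add: K_def)
    have "q \<noteq> 0" using a p theta_nz by simp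
    moreover have "q / p = \<theta>\<^sub>0" using a p by simp
    ultimately show "q \<noteq> 0 \<and> arc_sigma p q = \<sigma>\<^sub>0 \<and> arc_Q p q = Q\<^sub>0"
      using arc_Q_eq_tan_profile[of q p \<sigma>\<^sub>0] s p value0 by simp
  qed
  have points: "{(p, q). q \<noteq> 0 \<and> arc_sigma p q = \<sigma>\<^sub>0 \<and> arc_Q p q = Q\<^sub>0} = {(p\<^sub>1, q\<^sub>1), (p\<^sub>2, q\<^sub>2)}"
    unfolding point_iff by (auto simp: power2_eq_iff pq2 q1)

  show ?thesis using r12_eq cases_eq angles polar polar' points by blast
qed

end
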